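(* Let $d\ge1$, let $\mathbf{X}$ be an integrable random matrix taking values in a set $\mathcal{X}\subseteq\mathcal{S}_d^{+}$, and let $U$ be a random variable uniformly distributed on $(0,1)$ and independent of $\mathbf{X}$. Then for any deterministic $\mathbf{A}\in\mathcal{S}_d^{++}$, $$\mathbb{P}(\mathbf{X}\not\preceq U\mathbf{A})\le\mathrm{tr}\big((\mathbb{E}\,\mathbf{X})\mathbf{A}^{-1}\big).$$
   Context: $\mathcal{S}_d$ is the set of real symmetric $d\times d$ matrices, $\mathcal{S}_d^{+}$ the subset of positive semidefinite ones, $\mathcal{S}_d^{++}$ the subset of positive definite ones. $\preceq$ is the Loewner order: $\mathbf{A}\preceq\mathbf{B}$ iff $\mathbf{B}-\mathbf{A}$ is positive semidefinite; $\mathbf{A}\not\preceq\mathbf{B}$ is its negation. Expectations are entrywise. *)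

theory Defs
  imports "HOL-Probability.Probability"
begin

definition sym_mats :: "(real ^ 'd ^ 'd) set" where
  "sym_mats = {A. transpose A = A}"

definition psd_mats :: "(real ^ 'd ^ 'd) set" where
  "psd_mats = {A \<in> sym_mats. \<forall>v. 0 \<le> v \<bullet> (A *v v)}"

definition pd_mats :: "(real ^ 'd ^ 'd) set" where
  "pd_mats = {A \<in> sym_mats. \<forall>v. v \<noteq> 0 \<longrightarrow> 0 < v \<bullet> (A *v v)}"

(* The order on vectors in the library, and hence on matrices, is the entrywise one, so the
   Loewner order has its own symbol. *)
definition loewner_le :: "real ^ 'd ^ 'd \<Rightarrow> real ^ 'd ^ 'd \<Rightarrow> bool" (infix \<open>\<preceq>\<^sub>L\<close> 50) where
  "A \<preceq>\<^sub>L B \<longleftrightarrow> B - A \<in> psd_mats"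

definition mat_expectation :: "'a measure \<Rightarrow> ('a \<Rightarrow> real ^ 'd ^ 'd) \<Rightarrow> real ^ 'd ^ 'd" where
  "mat_expectation M X = (\<chi> i j. \<integral>\<omega>. X \<omega> $ i $ j \<partial>M)"

lemma mat_expectation_eq_integral:
  assumes "integrable M X"
  shows "mat_expectation M X = integral\<^sup>L M X"
proof -
  have row: "integrable M (\<lambda>\<omega>. X \<omega> $ i)" for i
    by (rule integrable_bounded_linear[OF bounded_linear_vec_nth assms])
  have "integral\<^sup>L M X $ i $ j = (\<integral>\<omega>. X \<omega> $ i $ j \<partial>M)" for i j
    by (simp add: integral_bounded_linear[OF bounded_linear_vec_nth assms, symmetric]
        integral_bounded_linear[OF bounded_linear_vec_nth row, symmetric])
  then show ?thesis
    by (simp add: mat_expectation_def vec_eq_iff)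
qed

(* The library's indep_var forces both random variables to have the same codomain type. This is
   the same notion for two variables with different codomains. *)
definition (in prob_space) indep_rv ::
    "'b measure \<Rightarrow> ('a \<Rightarrow> 'b) \<Rightarrow> 'c measure \<Rightarrow> ('a \<Rightarrow> 'c) \<Rightarrow> bool" where
  "indep_rv N X L Y \<longleftrightarrow> random_variable N X \<and> random_variable L Y \<and>
     indep_set {X -` S \<inter> space M | S. S \<in> sets N} {Y -` T \<inter> space M | T. T \<in> sets L}"

lemma (in prob_space) indep_rv_iff_indep_var:
  "indep_rv N X L Y \<longleftrightarrow> indep_var N X L Y"
proof -
  have "case_bool {X -` S \<inter> space M | S. S \<in> sets N} {Y -` T \<inter> space M | T. T \<in> sets L} =
      (\<lambda>i. {case_bool X Y i -` S \<inter> space M | S. S \<in> sets (case_bool N L i)})"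
    by (rule ext) (simp split: bool.split)
  then show ?thesis
    unfolding indep_rv_def indep_var_def indep_vars_def2 indep_set_def UNIV_bool by auto
qed

end

theory Submission
  imports Defs
begin

text \<open>
  Put \<open>T = tr (X A\<^sup>-\<^sup>1)\<close>. For positive semidefinite \<open>X\<close> one has
  \<open>v \<bullet> X v \<le> T (v \<bullet> A v)\<close> for all \<open>v\<close>, so \<open>X \<preceq> U A\<close> as soon as \<open>T \<le> U\<close>. Hence the event is
  contained in \<open>{U < T}\<close>. Conditionally on \<open>X\<close> this has probability \<open>min T 1 \<le> T\<close>, and the bound
  follows by taking expectations.

  The quadratic form inequality is \<open>tr (X C) \<ge> 0\<close> for \<open>C = A\<^sup>-\<^sup>1 - v v\<^sup>T / (v \<bullet> A v)\<close>. Both the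
  semidefiniteness of \<open>C\<close> and the fact that the product of two positive semidefinite matrices has
  nonnegative trace come from one deflation step, \<open>C \<mapsto> C - (C u) (C u)\<^sup>T / (u \<bullet> C u)\<close>, which
  preserves semidefiniteness by the Cauchy--Schwarz inequality.
\<close>

section \<open>Rank-one matrices and symmetric forms\<close>

definition outer :: "real ^ 'd \<Rightarrow> real ^ 'd ^ 'd" where
  "outer v = (\<chi> i j. v $ i * v $ j)"

lemma inner_outer_mult: "x \<bullet> (outer v *v x) = (x \<bullet> v)\<^sup>2"
proof -
  have "outer v *v x = (x \<bullet> v) *\<^sub>R v"
    by (simp add: outer_def matrix_vector_mult_def vec_eq_iff inner_vec_def sum_distrib_left mult_ac)
  then show ?thesis
    by (simp add: power2_eq_square)
qed

lemma transpose_outer: "transpose (outer v) = outer v"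
  by (simp add: outer_def transpose_def vec_eq_iff mult.commute)

text \<open>The trace of \<open>X ** outer w\<close> is the quadratic form of \<open>X\<close> at
  \<open>w\<close>, so a rank-one correction of \<open>C\<close> changes the trace by a term whose
  sign is known once \<open>X\<close> is semidefinite.\<close>

lemma trace_mult_add_outer:
  fixes X C :: "real ^ 'd ^ 'd"
  shows "trace (X ** (C + c *\<^sub>R outer w)) = trace (X ** C) + c * (w \<bullet> (X *v w))"
proof -
  have "X ** (C + c *\<^sub>R outer w) = X ** C + c *\<^sub>R (X ** outer w)"
    by (simp only: matrix_add_ldistrib matrix_scalar_ac scalar_matrix_assoc)
  moreover have "trace (X ** outer w) = w \<bullet> (X *v w)"
    by (simp add: trace_def outer_def matrix_matrix_mult_def matrix_vector_mult_def inner_vec_def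
        sum_distrib_left mult_ac)
  ultimately show ?thesis
    by (simp add: trace_def sum.distrib flip: sum_distrib_left)
qed

lemma transpose_diff: "transpose (A - B) = transpose A - transpose (B :: real ^ 'n ^ 'm)"
  by (simp add: transpose_def vec_eq_iff)

lemma inner_symmetric_mult:
  fixes C :: "real ^ 'd ^ 'd"
  assumes "C \<in> sym_mats"
  shows "x \<bullet> (C *v y) = y \<bullet> (C *v x)"
  using assms dot_lmul_matrix[of x C y] transpose_matrix_vector[of C x]
  by (simp add: sym_mats_def inner_commute)

lemma linear_trace_mult: "linear (\<lambda>X :: real ^ 'd ^ 'd. trace (X ** B))"
  by (rule linearI)
    (simp_all add: trace_def matrix_matrix_mult_def sum.distrib sum_distrib_left algebra_simps)

section \<open>Deflation and traces of products of semidefinite matrices\<close>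

lemma psd_deflation:
  fixes C :: "real ^ 'd ^ 'd"
  assumes C: "C \<in> psd_mats" and pos: "0 < u \<bullet> (C *v u)"
  shows "C - (1 / (u \<bullet> (C *v u))) *\<^sub>R outer (C *v u) \<in> psd_mats"
proof -
  let ?q = "u \<bullet> (C *v u)"
  have sym: "C \<in> sym_mats"
    using C by (simp add: psd_mats_def)
  have "0 \<le> x \<bullet> ((C - (1 / ?q) *\<^sub>R outer (C *v u)) *v x)" for x
  proof -
    \<comment> \<open>This \<open>t\<close> minimises the quadratic form of \<open>C\<close> along
      the line \<open>x - t *\<^sub>R u\<close>; the minimum is exactly the deflated form at
      \<open>x\<close>.\<close>
    define t where "t = (x \<bullet> (C *v u)) / ?q"
    have "0 \<le> (x - t *\<^sub>R u) \<bullet> (C *v (x - t *\<^sub>R u))"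
      using C by (simp add: psd_mats_def)
    also have "\<dots> = x \<bullet> (C *v x) - 2 * t * (x \<bullet> (C *v u)) + t\<^sup>2 * ?q"
      using inner_symmetric_mult[OF sym, of u x]
      by (simp add: matrix_vector_mult_diff_distrib matrix_vector_mult_scaleR inner_diff_left
          inner_diff_right power2_eq_square algebra_simps)
    also have "\<dots> = x \<bullet> (C *v x) - (x \<bullet> (C *v u))\<^sup>2 / ?q"
      using pos by (simp add: t_def power2_eq_square field_simps)
    also have "\<dots> = x \<bullet> ((C - (1 / ?q) *\<^sub>R outer (C *v u)) *v x)"
      by (simp add: matrix_vector_mult_diff_rdistrib scaleR_matrix_vector_assoc[symmetric]
          inner_diff_right inner_outer_mult)
    finally show ?thesis .
  qed
  moreover have "transpose (C - (1 / ?q) *\<^sub>R outer (C *v u)) = C - (1 / ?q) *\<^sub>R outer (C *v u)"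
    using sym by (simp add: sym_mats_def transpose_diff transpose_scalar transpose_outer)
  ultimately show ?thesis
    by (simp add: psd_mats_def sym_mats_def)
qed

lemma psd_diag_nonneg:
  fixes C :: "real ^ 'd ^ 'd"
  assumes "C \<in> psd_mats"
  shows "0 \<le> C $ i $ i"
proof -
  have "0 \<le> axis i 1 \<bullet> (C *v axis i 1)"
    using assms by (simp add: psd_mats_def)
  then show ?thesis
    by (simp add: matrix_vector_mul_component inner_axis inner_axis' column_def matrix_vector_mult_basis)
qed

text \<open>With zero diagonal, the form at \<open>axis i 1 + s *\<^sub>R axis j 1\<close> is linear
  in \<open>s\<close>, so it can be nonnegative for both signs of \<open>s\<close> only if its slope
  vanishes.\<close>

lemma psd_zero_diag_imp_zero:
  fixes C :: "real ^ 'd ^ 'd"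
  assumes C: "C \<in> psd_mats" and diag: "\<And>i. C $ i $ i = 0"
  shows "C = 0"
proof -
  have "C $ i $ j = 0" for i j
  proof -
    have sym: "C $ j $ i = C $ i $ j"
      using C by (auto simp: psd_mats_def sym_mats_def transpose_def vec_eq_iff)
    have "0 \<le> (axis i 1 + s *\<^sub>R axis j 1) \<bullet> (C *v (axis i 1 + s *\<^sub>R axis j 1))" for s
      using C by (simp add: psd_mats_def)
    then have "0 \<le> 2 * s * C $ i $ j" for s
      by (simp add: matrix_vector_right_distrib matrix_vector_mult_scaleR inner_add_left
          inner_axis' column_def matrix_vector_mult_basis diag sym)
    from this[of 1] this[of "-1"] show ?thesis
      by simp
  qed
  then show ?thesis
    by (simp add: vec_eq_iff)
qed

text \<open>Each deflation at a basis vector clears one nonzero diagonal entry of \<open>C\<close>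
  and revives none, so the number of nonzero diagonal entries serves as induction measure. The piece
  removed contributes \<open>(1 / q) * (w \<bullet> (X *v w))\<close>, which is nonnegative.\<close>

lemma trace_mult_psd_nonneg:
  fixes X C :: "real ^ 'd ^ 'd"
  assumes X: "X \<in> psd_mats" and "C \<in> psd_mats"
  shows "0 \<le> trace (X ** C)"
  using assms(2)
proof (induction "card {i. C $ i $ i \<noteq> 0}" arbitrary: C rule: less_induct)
  case less
  show ?case
  proof (cases "\<forall>i. C $ i $ i = 0")
    case True
    then have "C = 0"
      using psd_zero_diag_imp_zero less.prems by blast
    then show ?thesis
      by (simp add: trace_def)
  next
    case False
    then obtain i where i: "C $ i $ i \<noteq> 0"
      by blast
    define w where "w = C *v axis i 1"
    define q where "q = axis i 1 \<bullet> w"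
    define C' where "C' = C - (1 / q) *\<^sub>R outer w"
    have w: "w $ j = C $ j $ i" for j
      by (simp add: w_def column_def matrix_vector_mult_basis)
    then have q: "q = C $ i $ i"
      by (simp add: q_def inner_axis')
    then have "0 < q"
      using i psd_diag_nonneg[OF less.prems, of i] by simp
    then have C': "C' \<in> psd_mats"
      using psd_deflation[OF less.prems, of "axis i 1"] by (simp add: C'_def q_def w_def)
    have diag: "C' $ j $ j = C $ j $ j - (w $ j)\<^sup>2 / q" for j
      by (simp add: C'_def outer_def power2_eq_square)
    \<comment> \<open>Deflation can only lower a diagonal entry, and semidefiniteness of
      \<open>C'\<close> keeps it from becoming negative.\<close>
    have "C' $ j $ j = 0" if "C $ j $ j = 0" for j
      using psd_diag_nonneg[OF C', of j] that \<open>0 < q\<close> diag[of j]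
      by (simp add: zero_le_divide_iff divide_le_0_iff)
    moreover have "C' $ i $ i = 0"
      using \<open>0 < q\<close> by (simp add: diag w q power2_eq_square)
    ultimately have "{j. C' $ j $ j \<noteq> 0} \<subset> {j. C $ j $ j \<noteq> 0}"
      using i by blast
    then have "0 \<le> trace (X ** C')"
      using less.hyps C' by (simp add: psubset_card_mono)
    moreover have "0 \<le> w \<bullet> (X *v w)"
      using X by (simp add: psd_mats_def)
    moreover have "trace (X ** C) = trace (X ** C') + (1 / q) * (w \<bullet> (X *v w))"
      using trace_mult_add_outer[of X C' "1 / q" w] by (simp add: C'_def)
    ultimately show ?thesis
      using \<open>0 < q\<close> by simp
  qed
qed

section \<open>Inverses of positive definite matrices\<close>

lemma pd_imp_psd:
  assumes "A \<in> pd_mats"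
  shows "A \<in> psd_mats"
proof -
  have "0 \<le> v \<bullet> (A *v v)" for v
    using assms by (cases "v = 0") (auto simp: pd_mats_def less_imp_le)
  then show ?thesis
    using assms by (simp add: pd_mats_def psd_mats_def)
qed

lemma pd_invertible:
  fixes A :: "real ^ 'd ^ 'd"
  assumes "A \<in> pd_mats"
  shows "invertible A"
proof -
  have "x = 0" if "A *v x = 0" for x
    using assms that by (force simp: pd_mats_def)
  then show ?thesis
    by (simp add: invertible_left_inverse matrix_left_invertible_ker)
qed

lemma pd_matrix_inv:
  fixes A :: "real ^ 'd ^ 'd"
  assumes "A \<in> pd_mats"
  shows "A ** matrix_inv A = mat 1" and "matrix_inv A ** A = mat 1"
proof -
  have "A ** matrix_inv A = mat 1 \<and> matrix_inv A ** A = mat 1"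
    unfolding matrix_inv_def by (rule someI_ex) (rule pd_invertible[OF assms, unfolded invertible_def])
  then show "A ** matrix_inv A = mat 1" "matrix_inv A ** A = mat 1"
    by blast+
qed

text \<open>Substituting \<open>x = A *v y\<close> with \<open>y = ?B *v x\<close> turns the form of
  the inverse at \<open>x\<close> into the form of \<open>A\<close> at \<open>y\<close>. Symmetry is
  uniqueness of inverses: \<open>transpose ?B\<close> is a left inverse of \<open>A\<close>.\<close>

lemma psd_matrix_inv:
  fixes A :: "real ^ 'd ^ 'd"
  assumes A: "A \<in> pd_mats"
  shows "matrix_inv A \<in> psd_mats"
proof -
  let ?B = "matrix_inv A"
  have AB: "A ** ?B = mat 1" and BA: "?B ** A = mat 1"
    using A by (rule pd_matrix_inv)+
  have "0 \<le> x \<bullet> (?B *v x)" for x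
  proof -
    have "A *v (?B *v x) = x"
      by (simp add: matrix_vector_mul_assoc AB)
    moreover have "0 \<le> (?B *v x) \<bullet> (A *v (?B *v x))"
      using pd_imp_psd[OF A] unfolding psd_mats_def by blast
    ultimately show ?thesis
      by (simp only: inner_commute)
  qed
  moreover have "transpose ?B = ?B"
  proof -
    have "transpose A = A"
      using A by (simp add: pd_mats_def sym_mats_def)
    then have "transpose ?B ** A = transpose (A ** ?B)"
      by (simp add: matrix_transpose_mul)
    then have inv: "transpose ?B ** A = mat 1"
      by (simp add: AB)
    have "transpose ?B = transpose ?B ** (A ** ?B)"
      by (simp add: AB)
    also have "\<dots> = ?B"
      by (simp only: matrix_mul_assoc inv matrix_mul_lid)
    finally show ?thesis .
  qed
  ultimately show ?thesis
    by (simp add: psd_mats_def sym_mats_def)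
qed

section \<open>Comparison with multiples of a positive definite matrix\<close>

lemma psd_quadratic_form_le:
  fixes X A :: "real ^ 'd ^ 'd"
  assumes X: "X \<in> psd_mats" and A: "A \<in> pd_mats"
  shows "v \<bullet> (X *v v) \<le> trace (X ** matrix_inv A) * (v \<bullet> (A *v v))"
proof (cases "v = 0")
  case True
  then show ?thesis
    by simp
next
  case False
  let ?B = "matrix_inv A" and ?u = "A *v v"
  define q where "q = v \<bullet> (A *v v)"
  define C where "C = ?B - (1 / q) *\<^sub>R outer v"
  have "0 < q"
    using A False by (simp add: q_def pd_mats_def)
  have Bu: "?B *v ?u = v"
    by (simp add: matrix_vector_mul_assoc pd_matrix_inv[OF A])
  \<comment> \<open>Deflating the inverse at \<open>?u\<close> gives exactly \<open>C\<close>: the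
    removed direction is \<open>?B *v ?u = v\<close>, and the divisor \<open>?u \<bullet> v\<close>
    equals \<open>q\<close>.\<close>
  have "C \<in> psd_mats"
    using psd_deflation[OF psd_matrix_inv[OF A], of ?u] \<open>0 < q\<close>
    by (simp add: Bu C_def q_def inner_commute)
  then have "0 \<le> trace (X ** C)"
    by (rule trace_mult_psd_nonneg[OF X])
  moreover have "trace (X ** ?B) = trace (X ** C) + (1 / q) * (v \<bullet> (X *v v))"
    using trace_mult_add_outer[of X C "1 / q" v] by (simp add: C_def)
  ultimately have "(v \<bullet> (X *v v)) / q \<le> trace (X ** ?B)"
    by simp
  then show ?thesis
    using \<open>0 < q\<close> by (simp add: divide_le_eq flip: q_def)
qed

lemma loewner_le_scaleR_if_trace_le:
  fixes X A :: "real ^ 'd ^ 'd"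
  assumes X: "X \<in> psd_mats" and A: "A \<in> pd_mats" and le: "trace (X ** matrix_inv A) \<le> u"
  shows "X \<preceq>\<^sub>L u *\<^sub>R A"
proof -
  have "v \<bullet> (X *v v) \<le> u * (v \<bullet> (A *v v))" for v
  proof -
    have "0 \<le> v \<bullet> (A *v v)"
      using pd_imp_psd[OF A] by (simp add: psd_mats_def)
    then show ?thesis
      using psd_quadratic_form_le[OF X A, of v] le by (meson mult_right_mono order_trans)
  qed
  then have "0 \<le> v \<bullet> ((u *\<^sub>R A - X) *v v)" for v
    by (simp add: matrix_vector_mult_diff_rdistrib scaleR_matrix_vector_assoc[symmetric]
        inner_diff_right)
  moreover have "transpose X = X" "transpose A = A"
    using X A by (simp_all add: psd_mats_def pd_mats_def sym_mats_def)
  ultimately show ?thesis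
    by (simp add: loewner_le_def psd_mats_def sym_mats_def transpose_diff transpose_scalar)
qed

section \<open>Independence and the uniform variable\<close>

lemma (in prob_space) indep_rv_compose:
  assumes ind: "indep_rv N X L Y" and h: "h \<in> measurable N K"
  shows "indep_rv K (\<lambda>\<omega>. h (X \<omega>)) L Y"
proof -
  have X: "random_variable N X"
    using ind by (simp add: indep_rv_def)
  \<comment> \<open>Every event generated by the composition is already generated by
    \<open>X\<close>, and independence passes to subfamilies.\<close>
  have "{(\<lambda>\<omega>. h (X \<omega>)) -` S \<inter> space M | S. S \<in> sets K} \<subseteq> {X -` S \<inter> space M | S. S \<in> sets N}"
  proof clarify
    fix S assume "S \<in> sets K"
    then have "h -` S \<inter> space N \<in> sets N"
      using h by (rule measurable_sets[rotated])
    moreover have "(\<lambda>\<omega>. h (X \<omega>)) -` S \<inter> space M = X -` (h -` S \<inter> space N) \<inter> space M"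
      using measurable_space[OF X] by auto
    ultimately show "\<exists>S'. (\<lambda>\<omega>. h (X \<omega>)) -` S \<inter> space M = X -` S' \<inter> space M \<and> S' \<in> sets N"
      by blast
  qed
  then have "indep_set {(\<lambda>\<omega>. h (X \<omega>)) -` S \<inter> space M | S. S \<in> sets K}
      {Y -` T \<inter> space M | T. T \<in> sets L}"
    using ind unfolding indep_rv_def indep_sets2_eq by (meson subset_iff)
  then show ?thesis
    using ind measurable_compose[OF X h] by (simp add: indep_rv_def)
qed

text \<open>The exact value is \<open>min t 1\<close>; the bound is strict for
  \<open>t > 1\<close>.\<close>

lemma uniform_measure_lessThan_le:
  assumes "0 \<le> t"
  shows "emeasure (uniform_measure lborel {0<..<1::real}) {..<t} \<le> ennreal t"
proof -
  have "emeasure (uniform_measure lborel {0<..<1::real}) {..<t} = emeasure lborel ({0<..<1} \<inter> {..<t})"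
    by (simp add: emeasure_uniform_measure divide_ennreal_def)
  also have "\<dots> \<le> emeasure lborel {0<..<t}"
    by (rule emeasure_mono) auto
  finally show ?thesis
    using assms by simp
qed

lemma (in prob_space) prob_uniform_less_le_expectation:
  fixes T U :: "'a \<Rightarrow> real"
  assumes T: "integrable M T" and nonneg: "\<And>\<omega>. \<omega> \<in> space M \<Longrightarrow> 0 \<le> T \<omega>"
    and U: "distr M borel U = uniform_measure lborel {0<..<1}"
    and ind: "indep_var borel T borel U"
  shows "prob {\<omega> \<in> space M. U \<omega> < T \<omega>} \<le> expectation T"
proof -
  have [measurable]: "random_variable borel T" "random_variable borel U"
    using indep_var_rv1[OF ind] indep_var_rv2[OF ind] .
  interpret D: prob_space "distr M borel U"
    by (rule prob_space_distr) simp
  let ?S = "{p :: real \<times> real. snd p < fst p}"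
  have S: "?S \<in> sets (borel \<Otimes>\<^sub>M borel)"
    unfolding borel_prod by (intro borel_open open_Collect_less continuous_intros)
  have "emeasure M {\<omega> \<in> space M. U \<omega> < T \<omega>}
      = emeasure (distr M (borel \<Otimes>\<^sub>M borel) (\<lambda>\<omega>. (T \<omega>, U \<omega>))) ?S"
    using S by (subst emeasure_distr) (auto intro!: arg_cong[where f = "emeasure M"])
  \<comment> \<open>Independence makes the joint law a product, so the event can be measured by its
    slices at fixed values \<open>t\<close> of \<open>T\<close>.\<close>
  also have "\<dots> = emeasure (distr M borel T \<Otimes>\<^sub>M distr M borel U) ?S"
    using ind by (simp add: indep_var_distribution_eq)
  also have "\<dots> = (\<integral>\<^sup>+t. emeasure (distr M borel U) (Pair t -` ?S) \<partial>distr M borel T)"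
    using S by (intro D.emeasure_pair_measure_alt)
      (simp cong: sets_pair_measure_cong)
  also have "\<dots> = (\<integral>\<^sup>+\<omega>. emeasure (uniform_measure lborel {0<..<1}) {..<T \<omega>} \<partial>M)"
  proof -
    have "Pair t -` ?S = {..<t}" for t
      by auto
    moreover have "(\<lambda>t. emeasure (distr M borel U) (Pair t -` ?S)) \<in> borel_measurable borel"
      using D.measurable_emeasure_Pair[of ?S borel] S by (simp cong: sets_pair_measure_cong)
    ultimately show ?thesis
      by (simp add: nn_integral_distr U)
  qed
  also have "\<dots> \<le> (\<integral>\<^sup>+\<omega>. ennreal (T \<omega>) \<partial>M)"
    by (intro nn_integral_mono uniform_measure_lessThan_le nonneg)
  also have "\<dots> = ennreal (expectation T)"
    using T nonneg by (intro nn_integral_eq_integral) auto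
  finally show ?thesis
    using nonneg by (simp add: emeasure_eq_measure ennreal_le_iff integral_nonneg_AE)
qed

theorem theorem5p3:
  fixes M :: "'a measure"
    and X :: "'a \<Rightarrow> real ^ 'd ^ 'd"
    and U :: "'a \<Rightarrow> real"
    and \<X> :: "(real ^ 'd ^ 'd) set"
    and A :: "real ^ 'd ^ 'd"
  assumes "prob_space M"
    and "\<X> \<subseteq> psd_mats"
    and "integrable M X"
    and "\<And>\<omega>. \<omega> \<in> space M \<Longrightarrow> X \<omega> \<in> \<X>"
    and "U \<in> borel_measurable M"
    and "distr M borel U = uniform_measure lborel {0<..<1}"
    and "prob_space.indep_rv M borel X borel U"
    and "A \<in> pd_mats"
  shows "measure M {\<omega> \<in> space M. \<not> X \<omega> \<preceq>\<^sub>L U \<omega> *\<^sub>R A}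
           \<le> trace (mat_expectation M X ** matrix_inv A)"
proof -
  interpret prob_space M
    by fact
  define h where "h = (\<lambda>Y :: real ^ 'd ^ 'd. trace (Y ** matrix_inv A))"
  \<comment> \<open>Linear maps on a finite-dimensional space are bounded. This yields measurability
    and integrability of \<open>h (X \<omega>)\<close>, and later lets \<open>h\<close> commute with
    the expectation.\<close>
  have h: "bounded_linear h"
    unfolding h_def using linear_trace_mult by (rule linear_conv_bounded_linear[THEN iffD1])
  then have [measurable]: "h \<in> borel_measurable borel"
    by (intro borel_measurable_continuous_onI linear_continuous_on)
  have psd: "X \<omega> \<in> psd_mats" if "\<omega> \<in> space M" for \<omega>
    using assms(2) assms(4)[OF that] by blast
  have T: "integrable M (\<lambda>\<omega>. h (X \<omega>))"
    using h assms(3) by (rule integrable_bounded_linear)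
  have [measurable]: "X \<in> borel_measurable M" "U \<in> borel_measurable M"
    using assms(3,5) by (simp_all add: borel_measurable_integrable)
  have "{\<omega> \<in> space M. \<not> X \<omega> \<preceq>\<^sub>L U \<omega> *\<^sub>R A} \<subseteq> {\<omega> \<in> space M. U \<omega> < h (X \<omega>)}"
    using loewner_le_scaleR_if_trace_le[OF psd assms(8)] by (auto simp: h_def not_less[symmetric])
  then have "prob {\<omega> \<in> space M. \<not> X \<omega> \<preceq>\<^sub>L U \<omega> *\<^sub>R A} \<le> prob {\<omega> \<in> space M. U \<omega> < h (X \<omega>)}"
    \<comment> \<open>Monotonicity asks for measurability of the larger event, which compares two
      real random variables.\<close>
    by (intro finite_measure_mono) measurable
  also have "\<dots> \<le> expectation (\<lambda>\<omega>. h (X \<omega>))"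
  proof (rule prob_uniform_less_le_expectation[OF T _ assms(6)])
    show "0 \<le> h (X \<omega>)" if "\<omega> \<in> space M" for \<omega>
      unfolding h_def by (intro trace_mult_psd_nonneg psd that psd_matrix_inv assms(8))
    \<comment> \<open>Applying \<open>h\<close> makes both variables real-valued, so
      \<open>indep_rv\<close> can be traded for \<open>indep_var\<close>.\<close>
    show "indep_var borel (\<lambda>\<omega>. h (X \<omega>)) borel U"
      using indep_rv_compose[OF assms(7), of h borel] by (simp add: indep_rv_iff_indep_var)
  qed
  also have "\<dots> = h (mat_expectation M X)"
    using integral_bounded_linear[OF h assms(3)] by (simp add: mat_expectation_eq_integral[OF assms(3)])
  finally show ?thesis
    by (simp add: h_def)
qed

end
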